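(* Consider the problem (P1) of minimizing $\tfrac12 x^THx+c^Tx+f_0(y)$ over $(x,y)\in\mathbb{R}^n\times\mathbb{R}^m$ subject to $x^Tx+f(y)\le 0$, where $n\ge 2$, $H=H^T\in\mathbb{R}^{n\times n}$ is not positive semidefinite, $c\in\mathbb{R}^n$, $f_0,f:\mathbb{R}^m\to\mathbb{R}$ are convex and twice continuously differentiable, and $\{y: f(y)<0\}\neq\emptyset$. Let $\lambda_1\le\lambda_2\le\dots\le\lambda_n$ be the eigenvalues of $H$ counted with multiplicity, and let $\varphi(\mu)=\|(H+\mu I)^{-1}c\|^2$ for $\mu\in(-\lambda_2,-\lambda_1)$. Assume that for every $y\in\mathbb{R}^m$ with $f(y)<0$ there is some $\mu_y>0$ with $\nabla^2f_0(y)+\frac{\mu_y}{2}\nabla^2f(y)\succ 0$. Let $(x_*,y_* )\in\mathbb{R}^n\times\mathbb{R}^m$. If there is $\mu^*\in(\max\{0,-\lambda_2\},-\lambda_1)$ satisfying $$(H+\mu^*I)x_*=-c,\qquad \nabla f_0(y_* )+\tfrac{\mu^*}{2}\nabla f(y_* )=0,\qquad x_*^Tx_*+f(y_* )=0,$$ and $$\varphi'(\mu^* )\ >\ \tfrac12\nabla f(y_* )^T\Big[\nabla^2f_0(y_* )+\tfrac{\mu^*}{2}\nabla^2f(y_* )\Big]^{-1}\nabla f(y_* ),$$ then $(x_*,y_* )$ is a strict local minimizer of (P1).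
   Context: $I$ is the $n\times n$ identity matrix, $\|\cdot\|$ is the Euclidean norm, $P\succ 0$ means that the symmetric matrix $P$ is positive definite, and $\varphi'$ is the derivative of $\varphi$. *)

theory Defs
  imports "HOL-Analysis.Analysis" "HOL-Computational_Algebra.Polynomial"
begin

definition charpoly :: "real ^ 'n ^ 'n \<Rightarrow> real poly" where
  "charpoly A = det (mat [:0, 1:] - (\<chi> i j. [:A $ i $ j:]))"

text \<open>The eigenvalues of \<open>A\<close> in nondecreasing order, repeated according to algebraic
  multiplicity and numbered from 1 to the dimension.\<close>

definition ordered_eigenvalues :: "real ^ 'n ^ 'n \<Rightarrow> (nat \<Rightarrow> real) \<Rightarrow> bool" where
  "ordered_eigenvalues A lam \<longleftrightarrow>
     mono_on {1..CARD('n)} lam \<and> charpoly A = (\<Prod>i = 1..CARD('n). [:- lam i, 1:])"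

definition pos_semidef :: "real ^ 'n ^ 'n \<Rightarrow> bool" where
  "pos_semidef A \<longleftrightarrow> transpose A = A \<and> (\<forall>v. 0 \<le> v \<bullet> (A *v v))"

definition pos_def :: "real ^ 'n ^ 'n \<Rightarrow> bool" where
  "pos_def A \<longleftrightarrow> transpose A = A \<and> (\<forall>v. v \<noteq> 0 \<longrightarrow> 0 < v \<bullet> (A *v v))"

definition grad :: "(real ^ 'm \<Rightarrow> real) \<Rightarrow> real ^ 'm \<Rightarrow> real ^ 'm" where
  "grad f y = (THE g. GDERIV f y :> g)"

definition hess :: "(real ^ 'm \<Rightarrow> real) \<Rightarrow> real ^ 'm \<Rightarrow> real ^ 'm ^ 'm" where
  "hess f y = matrix (frechet_derivative (grad f) (at y))"

definition twice_cont_diff :: "(real ^ 'm \<Rightarrow> real) \<Rightarrow> bool" where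
  "twice_cont_diff f \<longleftrightarrow>
     (\<forall>y. f differentiable (at y)) \<and> (\<forall>y. grad f differentiable (at y)) \<and>
     continuous_on UNIV (hess f)"

text \<open>The function \<open>phi H c\<close> is meaningful only at those \<open>\<mu>\<close> for which \<open>H + \<mu> I\<close> is
  invertible; for symmetric \<open>H\<close> this includes the open interval between the negatives of
  the two smallest eigenvalues.\<close>

definition phi :: "real ^ 'n ^ 'n \<Rightarrow> real ^ 'n \<Rightarrow> real \<Rightarrow> real" where
  "phi H c \<mu> = (norm (matrix_inv (H + \<mu> *\<^sub>R mat 1) *v c))\<^sup>2"

definition objective ::
  "real ^ 'n ^ 'n \<Rightarrow> real ^ 'n \<Rightarrow> (real ^ 'm \<Rightarrow> real) \<Rightarrow> (real ^ 'n) \<times> (real ^ 'm) \<Rightarrow> real" where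
  "objective H c f0 = (\<lambda>(x, y). (1/2) * (x \<bullet> (H *v x)) + c \<bullet> x + f0 y)"

definition feasible_set :: "(real ^ 'm \<Rightarrow> real) \<Rightarrow> ((real ^ 'n) \<times> (real ^ 'm)) set" where
  "feasible_set f = {(x, y). x \<bullet> x + f y \<le> 0}"

definition strict_local_minimizer :: "'a::metric_space set \<Rightarrow> ('a \<Rightarrow> real) \<Rightarrow> 'a \<Rightarrow> bool" where
  "strict_local_minimizer S F z \<longleftrightarrow>
     z \<in> S \<and> (\<exists>\<epsilon>>0. \<forall>w\<in>S. w \<noteq> z \<and> dist w z < \<epsilon> \<longrightarrow> F z < F w)"

end

(*
  The pair (xs, ys) is a stationary point of the Lagrangian F + (mu/2) g, whose Hessian there is
  M = diag(A, B) with A = H + mu I and B = hess f0 + (mu/2) hess f. Since -lam 2 < mu < -lam 1, the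
  block A has exactly one negative eigenvalue; B is positive semidefinite by convexity and
  invertible, hence positive definite. So M is positive on a hyperplane. With w = (2 xs, grad f ys)
  the gradient of the constraint, phi'(mu) = -2 xs . A^-1 xs turns the hypothesis into
  w . M^-1 w < 0. Thus p = M^-1 w is a negative direction whose M-orthogonal complement is the
  tangent space of the constraint, and a form with a single negative direction is positive on the
  M-orthogonal complement of p. The second-order sufficient condition concludes.
*)

theory Submission
  imports Defs
begin

subsection \<open>Second derivatives\<close>

text \<open>\<open>grad\<close> is a definite description, so existence and uniqueness must both be
  supplied: the adjoint of the derivative, applied to 1, is the representing vector, and derivatives
  are unique.\<close>

lemma has_derivative_grad:
  assumes "f differentiable (at y)"
  shows "(f has_derivative (\<lambda>h. grad f y \<bullet> h)) (at y)"
proof -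
  obtain f' where f': "(f has_derivative f') (at y)"
    using assms unfolding differentiable_def by blast
  then have "linear f'"
    by (rule has_derivative_linear)
  then have "f' = (\<lambda>h. h \<bullet> adjoint f' 1)"
    by (simp add: adjoint_works fun_eq_iff)
  then have ex: "GDERIV f y :> adjoint f' 1"
    using f' by (simp add: gderiv_def)
  moreover have "D = adjoint f' 1" if "GDERIV f y :> D" for D
    using has_derivative_unique[of f "\<lambda>h. h \<bullet> D" y "\<lambda>h. h \<bullet> adjoint f' 1"] that ex
    by (metis gderiv_def vector_eq_rdot inner_commute)
  ultimately have "GDERIV f y :> grad f y"
    unfolding grad_def by (rule theI)
  then show ?thesis
    by (simp add: gderiv_def inner_commute)
qed

lemma has_derivative_grad_hess:
  assumes "grad f differentiable (at y)"
  shows "(grad f has_derivative (\<lambda>h. hess f y *v h)) (at y)"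
proof -
  have D: "(grad f has_derivative frechet_derivative (grad f) (at y)) (at y)"
    using assms frechet_derivative_works by blast
  then have "linear (frechet_derivative (grad f) (at y))"
    by (rule has_derivative_linear)
  then have "(\<lambda>h. hess f y *v h) = frechet_derivative (grad f) (at y)"
    unfolding hess_def by (simp add: matrix_works fun_eq_iff)
  with D show ?thesis by simp
qed

lemma DERIV_along_line:
  fixes f :: "'a::real_inner \<Rightarrow> real"
  assumes "\<And>x. (f has_derivative (\<lambda>h. g x \<bullet> h)) (at x)"
  shows "((\<lambda>s. f (a + s *\<^sub>R b)) has_field_derivative (g (a + s *\<^sub>R b) \<bullet> b)) (at s)"
proof -
  have "((\<lambda>s. a + s *\<^sub>R b) has_derivative (\<lambda>t. t *\<^sub>R b)) (at s)"
    by (auto intro!: derivative_eq_intros)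
  then have "((\<lambda>s. f (a + s *\<^sub>R b)) has_derivative (\<lambda>t. g (a + s *\<^sub>R b) \<bullet> (t *\<^sub>R b))) (at s)"
    using assms has_derivative_compose by blast
  then show ?thesis
    by (simp add: has_field_derivative_def mult_commute_abs)
qed

text \<open>The mean value theorem turns the second difference into a difference of gradient values
  at two points near \<open>y\<close>. Expanding both by the derivative \<open>D\<close> of
  \<open>g\<close> at \<open>y\<close> leaves \<open>t\<^sup>2 * (u \<bullet> D v)\<close> up to an
  error of smaller order.\<close>

lemma second_difference_tendsto:
  fixes f :: "'a::real_inner \<Rightarrow> real"
  assumes f: "\<And>x. (f has_derivative (\<lambda>h. g x \<bullet> h)) (at x)"
    and g: "(g has_derivative D) (at y)"
  shows "((\<lambda>t. (f (y + t *\<^sub>R u + t *\<^sub>R v) - f (y + t *\<^sub>R u) - f (y + t *\<^sub>R v) + f y) / t\<^sup>2)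
           \<longlongrightarrow> u \<bullet> D v) (at_right 0)"
proof -
  let ?S = "\<lambda>t. f (y + t *\<^sub>R u + t *\<^sub>R v) - f (y + t *\<^sub>R u) - f (y + t *\<^sub>R v) + f y"
  interpret D: bounded_linear D
    using g by (rule has_derivative_bounded_linear)
  define C where "C = norm u * (2 * norm u + norm v)"
  have C: "C \<ge> 0" by (simp add: C_def)
  show ?thesis
  proof (rule tendstoI)
    fix e :: real assume e: "e > 0"
    \<comment> \<open>Chosen so that \<open>e1 * C \<le> e / 2\<close>; the added 1 covers
      \<open>C = 0\<close>.\<close>
    define e1 where "e1 = e / (2 * (C + 1))"
    have e1: "e1 > 0" using e C by (simp add: e1_def)
    then obtain d where d: "d > 0"
      and dd: "\<And>z. norm (z - y) < d \<Longrightarrow> norm (g z - g y - D (z - y)) \<le> e1 * norm (z - y)"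
      using g unfolding has_derivative_at_alt by blast
    define \<delta> where "\<delta> = d / (norm u + norm v + 1)"
    have \<delta>: "\<delta> > 0" using d unfolding \<delta>_def by (smt (verit) divide_pos_pos norm_ge_zero)
    have "dist (?S t / t\<^sup>2) (u \<bullet> D v) < e" if t: "0 < t" "t < \<delta>" for t
    proof -
      have td: "t * (norm u + norm v) < d"
      proof -
        have "t * (norm u + norm v) \<le> t * (norm u + norm v + 1)"
          using t by (simp add: algebra_simps)
        also have "\<dots> < \<delta> * (norm u + norm v + 1)"
          using t by (intro mult_strict_right_mono) (auto simp: add_nonneg_pos)
        also have "\<dots> = d" unfolding \<delta>_def
          by (smt (verit) norm_ge_zero nonzero_eq_divide_eq)
        finally show ?thesis .
      qed
      \<comment> \<open>The increment of \<open>f\<close> in direction \<open>v\<close> as a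
        function of the position along \<open>u\<close>; \<open>\<phi> 1 - \<phi> 0\<close> is the
        second difference.\<close>
      define \<phi> where "\<phi> = (\<lambda>s. f ((y + t *\<^sub>R v) + s *\<^sub>R (t *\<^sub>R u)) - f (y + s *\<^sub>R (t *\<^sub>R u)))"
      define \<phi>' where "\<phi>' = (\<lambda>s. g ((y + t *\<^sub>R v) + s *\<^sub>R (t *\<^sub>R u)) \<bullet> (t *\<^sub>R u)
                                  - g (y + s *\<^sub>R (t *\<^sub>R u)) \<bullet> (t *\<^sub>R u))"
      have "(\<phi> has_field_derivative \<phi>' s) (at s)" for s
        unfolding \<phi>_def \<phi>'_def by (intro DERIV_diff DERIV_along_line f)
      then obtain s where s: "0 < s" "s < 1" "\<phi> 1 - \<phi> 0 = \<phi>' s"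
        using MVT2[of 0 1 \<phi> \<phi>'] by auto
      define a where "a = t *\<^sub>R v + s *\<^sub>R (t *\<^sub>R u)"
      define b where "b = s *\<^sub>R (t *\<^sub>R u)"
      have nb: "norm b \<le> t * norm u"
        using s t mult_right_le_one_le[of "t * norm u" s] by (simp add: b_def ac_simps)
      have na: "norm a \<le> t * norm v + t * norm u"
        using norm_triangle_ineq[of "t *\<^sub>R v" b] nb t by (simp add: a_def b_def)
      have "norm b < d" "norm a < d"
        using na nb td t by (auto simp: algebra_simps) (smt (verit) mult_nonneg_nonneg norm_ge_zero)
      then have ra: "norm (g (y + a) - g y - D a) \<le> e1 * norm a"
        and rb: "norm (g (y + b) - g y - D b) \<le> e1 * norm b"
        using dd[of "y + a"] dd[of "y + b"] by auto
      \<comment> \<open>The gradient difference without its linear part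
        \<open>D (a - b) = t *\<^sub>R D v\<close>.\<close>
      let ?r = "g (y + a) - g (y + b) - t *\<^sub>R D v"
      have Dab: "D a = D b + t *\<^sub>R D v"
        by (simp add: a_def b_def D.add D.scaleR)
      have "norm ?r = norm ((g (y + a) - g y - D a) - (g (y + b) - g y - D b))"
        by (simp add: Dab algebra_simps)
      also have "\<dots> \<le> e1 * norm a + e1 * norm b"
        using ra rb norm_triangle_ineq4 by (smt (verit))
      also have "\<dots> \<le> e1 * (t * (2 * norm u + norm v))"
        unfolding distrib_left[symmetric]
        using na nb e1 by (intro mult_left_mono) (auto simp: algebra_simps)
      finally have r: "norm ?r \<le> e1 * (t * (2 * norm u + norm v))" .
      have "?S t = \<phi>' s"
        using s(3) by (simp add: \<phi>_def algebra_simps)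
      also have "\<dots> = t * (u \<bullet> (?r + t *\<^sub>R D v))"
        by (simp add: \<phi>'_def a_def b_def inner_diff_left inner_diff_right algebra_simps inner_commute)
      also have "\<dots> = t * (u \<bullet> ?r) + t\<^sup>2 * (u \<bullet> D v)"
        by (simp add: inner_add_right algebra_simps power2_eq_square)
      finally have S: "?S t = t * (u \<bullet> ?r) + t\<^sup>2 * (u \<bullet> D v)" .
      have "?S t / t\<^sup>2 - u \<bullet> D v = (u \<bullet> ?r) / t"
        unfolding S using t by (simp add: field_simps power2_eq_square)
      then have "dist (?S t / t\<^sup>2) (u \<bullet> D v) = \<bar>u \<bullet> ?r\<bar> / t"
        using t by (simp add: dist_real_def)
      also have "\<dots> \<le> norm u * norm ?r / t"
        using t Cauchy_Schwarz_ineq2 by (intro divide_right_mono) auto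
      also have "\<dots> \<le> norm u * (e1 * (t * (2 * norm u + norm v))) / t"
        using t r by (intro divide_right_mono mult_left_mono) auto
      also have "\<dots> = e1 * C"
        using t by (simp add: C_def)
      also have "\<dots> < e"
      proof -
        have "e1 * C \<le> e1 * (C + 1)" using e1 by simp
        also have "\<dots> = e / 2" using C by (simp add: e1_def field_simps)
        finally show ?thesis using e by simp
      qed
      finally show ?thesis .
    qed
    then show "\<forall>\<^sub>F t in at_right 0. dist (?S t / t\<^sup>2) (u \<bullet> D v) < e"
      using \<delta> by (auto simp: eventually_at_right_field)
  qed
qed

text \<open>Interchanging \<open>u\<close> and \<open>v\<close> leaves the second difference
  unchanged, and limits are unique.\<close>

lemma second_derivative_symmetric:
  fixes f :: "'a::real_inner \<Rightarrow> real"
  assumes f: "\<And>x. (f has_derivative (\<lambda>h. g x \<bullet> h)) (at x)"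
    and g: "(g has_derivative D) (at y)"
  shows "u \<bullet> D v = v \<bullet> D u"
proof (rule tendsto_unique[OF _ second_difference_tendsto[OF f g]])
  have "(\<lambda>t. (f (y + t *\<^sub>R u + t *\<^sub>R v) - f (y + t *\<^sub>R u) - f (y + t *\<^sub>R v) + f y) / t\<^sup>2)
      = (\<lambda>t. (f (y + t *\<^sub>R v + t *\<^sub>R u) - f (y + t *\<^sub>R v) - f (y + t *\<^sub>R u) + f y) / t\<^sup>2)"
    by (simp add: algebra_simps)
  then show "((\<lambda>t. (f (y + t *\<^sub>R u + t *\<^sub>R v) - f (y + t *\<^sub>R u) - f (y + t *\<^sub>R v) + f y) / t\<^sup>2)
           \<longlongrightarrow> v \<bullet> D u) (at_right 0)"
    using second_difference_tendsto[OF f g, of v u] by simp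
qed simp

text \<open>The mean value theorem along the segment from \<open>y\<close> to \<open>y + h\<close>
  reduces the remainder to the first-order remainder of \<open>g\<close> at \<open>y\<close>, paired
  with \<open>h\<close>.\<close>

lemma taylor2_peano:
  fixes f :: "'a::real_inner \<Rightarrow> real"
  assumes f: "\<And>x. (f has_derivative (\<lambda>h. g x \<bullet> h)) (at x)"
    and g: "(g has_derivative D) (at y)"
  shows "((\<lambda>h. (f (y + h) - f y - g y \<bullet> h - h \<bullet> D h / 2) / (norm h)\<^sup>2) \<longlongrightarrow> 0) (at 0)"
proof (rule tendstoI)
  fix e :: real assume e: "e > 0"
  interpret D: bounded_linear D
    using g by (rule has_derivative_bounded_linear)
  obtain d where d: "d > 0"
    and dd: "\<And>z. norm (z - y) < d \<Longrightarrow> norm (g z - g y - D (z - y)) \<le> e/2 * norm (z - y)"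
    using g e unfolding has_derivative_at_alt by (metis half_gt_zero)
  have "dist ((f (y + h) - f y - g y \<bullet> h - h \<bullet> D h / 2) / (norm h)\<^sup>2) 0 < e"
    if h: "h \<noteq> 0" "norm h < d" for h
  proof -
    define \<phi> where "\<phi> = (\<lambda>s. f (y + s *\<^sub>R h) - s * (g y \<bullet> h) - s\<^sup>2 * (h \<bullet> D h) / 2)"
    define \<phi>' where "\<phi>' = (\<lambda>s. g (y + s *\<^sub>R h) \<bullet> h - g y \<bullet> h - s * (h \<bullet> D h))"
    have "(\<phi> has_field_derivative \<phi>' s) (at s)" for s
      unfolding \<phi>_def \<phi>'_def
      by (rule derivative_eq_intros DERIV_along_line f refl | simp)+
    then obtain s where s: "0 < s" "s < 1" "\<phi> 1 - \<phi> 0 = \<phi>' s"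
      using MVT2[of 0 1 \<phi> \<phi>'] by auto
    have sh: "norm (s *\<^sub>R h) \<le> norm h"
      using s by (simp add: mult_left_le_one_le)
    let ?r = "g (y + s *\<^sub>R h) - g y - D (s *\<^sub>R h)"
    have r: "norm ?r \<le> e/2 * norm h"
      using dd[of "y + s *\<^sub>R h"] sh h e
      by (smt (verit) add_diff_cancel_left' mult_left_mono half_gt_zero)
    have "f (y + h) - f y - g y \<bullet> h - h \<bullet> D h / 2 = ?r \<bullet> h"
      using s(3) by (simp add: \<phi>_def \<phi>'_def inner_diff_left inner_diff_right D.scaleR inner_commute)
    then have "\<bar>f (y + h) - f y - g y \<bullet> h - h \<bullet> D h / 2\<bar> \<le> norm ?r * norm h"
      using Cauchy_Schwarz_ineq2 by metis
    also have "\<dots> \<le> e/2 * norm h * norm h"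
      using r by (intro mult_right_mono) auto
    also have "\<dots> < e * (norm h)\<^sup>2"
      using e h by (simp add: power2_eq_square)
    finally show ?thesis
      using h by (simp add: dist_real_def divide_less_eq)
  qed
  then show "\<forall>\<^sub>F h in at 0. dist ((f (y + h) - f y - g y \<bullet> h - h \<bullet> D h / 2) / (norm h)\<^sup>2) 0 < e"
    unfolding eventually_at using d by (auto simp: dist_norm)
qed

section \<open>Convex functions: tangent hyperplanes and second derivatives\<close>

lemma convex_on_above_tangent_hyperplane:
  fixes f :: "'a::real_inner \<Rightarrow> real"
  assumes f: "\<And>x. (f has_derivative (\<lambda>h. g x \<bullet> h)) (at x)"
    and conv: "convex_on UNIV f"
  shows "f y + g y \<bullet> h \<le> f (y + h)"
proof -
  have "convex_on UNIV (\<lambda>s. f (y + s *\<^sub>R h))"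
  proof (rule convex_onI)
    fix t x z :: real assume t: "0 < t" "t < 1"
    have "y + ((1 - t) *\<^sub>R x + t *\<^sub>R z) *\<^sub>R h = (1 - t) *\<^sub>R (y + x *\<^sub>R h) + t *\<^sub>R (y + z *\<^sub>R h)"
      by (simp add: algebra_simps)
    then show "f (y + ((1 - t) *\<^sub>R x + t *\<^sub>R z) *\<^sub>R h)
        \<le> (1 - t) * f (y + x *\<^sub>R h) + t * f (y + z *\<^sub>R h)"
      using convex_onD[OF conv, of t] t by simp
  qed auto
  from convex_on_imp_above_tangent[OF this, of 0 1 "g y \<bullet> h"]
  show ?thesis
    using DERIV_along_line[OF f, of y h 0] by simp
qed

text \<open>Lying above the tangent hyperplane bounds the Taylor remainder below by minus the
  second-order term, while the remainder divided by the squared norm tends to 0.\<close>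

lemma convex_on_second_derivative_nonneg:
  fixes f :: "'a::real_inner \<Rightarrow> real"
  assumes f: "\<And>x. (f has_derivative (\<lambda>h. g x \<bullet> h)) (at x)"
    and g: "(g has_derivative D) (at y)"
    and conv: "convex_on UNIV f"
  shows "0 \<le> v \<bullet> D v"
proof (cases "v = 0")
  case False
  interpret D: bounded_linear D
    using g by (rule has_derivative_bounded_linear)
  define R where "R = (\<lambda>h. (f (y + h) - f y - g y \<bullet> h - h \<bullet> D h / 2) / (norm h)\<^sup>2)"
  have "filterlim (\<lambda>t. t *\<^sub>R v) (at 0) (at (0::real))"
    unfolding filterlim_at using False
    by (auto intro!: tendsto_eq_intros simp: eventually_at_filter)
  then have lim: "((\<lambda>t. R (t *\<^sub>R v)) \<longlongrightarrow> 0) (at 0)"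
    using taylor2_peano[OF f g] unfolding R_def by (rule filterlim_compose[rotated])
  \<comment> \<open>The quadratic term and the squared norm both scale by \<open>t\<^sup>2\<close>,
    so the bound does not depend on \<open>t\<close>.\<close>
  have "- (v \<bullet> D v) / (2 * (norm v)\<^sup>2) \<le> R (t *\<^sub>R v)" if "t \<noteq> 0" for t
  proof -
    have "- ((t *\<^sub>R v) \<bullet> D (t *\<^sub>R v) / 2) / (norm (t *\<^sub>R v))\<^sup>2 \<le> R (t *\<^sub>R v)"
      unfolding R_def using convex_on_above_tangent_hyperplane[OF f conv, of y "t *\<^sub>R v"]
      by (intro divide_right_mono) auto
    moreover have "- ((t *\<^sub>R v) \<bullet> D (t *\<^sub>R v) / 2) / (norm (t *\<^sub>R v))\<^sup>2
        = - (v \<bullet> D v) / (2 * (norm v)\<^sup>2)"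
      using that False by (simp add: D.scaleR power_mult_distrib field_simps) (simp add: power2_eq_square)
    ultimately show ?thesis by simp
  qed
  then have "- (v \<bullet> D v) / (2 * (norm v)\<^sup>2) \<le> 0"
    by (intro tendsto_lowerbound[OF lim]) (auto simp: eventually_at_filter)
  then show ?thesis
    using False by (simp add: zero_le_divide_iff divide_le_0_iff)
qed (simp add: has_derivative_bounded_linear[OF g] linear_simps)

lemma has_derivative_twice_cont_diff:
  assumes "twice_cont_diff f"
  shows "(f has_derivative (\<lambda>h. grad f y \<bullet> h)) (at y)"
    and "(grad f has_derivative (\<lambda>h. hess f y *v h)) (at y)"
  using assms by (auto simp: twice_cont_diff_def intro: has_derivative_grad has_derivative_grad_hess)

text \<open>Otherwise feasible points with no larger objective value converge to \<open>z\<close>, and a limit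
  direction \<open>d\<close> of theirs would satisfy \<open>g' d = 0\<close> and \<open>Q d \<le> 0\<close>.\<close>

lemma strict_local_minimizer_second_order:
  fixes F g :: "'a::euclidean_space \<Rightarrow> real"
  assumes g: "(g has_derivative g') (at z)" and gz: "g z = 0" and m: "m > 0"
    and taylor: "((\<lambda>h. (F (z + h) + m * g (z + h) - F z - Q h) / (norm h)\<^sup>2) \<longlongrightarrow> 0) (at 0)"
    and Q_cont: "continuous_on UNIV Q" and Q_hom: "\<And>r h. Q (r *\<^sub>R h) = r\<^sup>2 * Q h"
    and Q_pos: "\<And>h. h \<noteq> 0 \<Longrightarrow> g' h = 0 \<Longrightarrow> Q h > 0"
  shows "strict_local_minimizer {z. g z \<le> 0} F z"
proof (rule ccontr)
  assume "\<not> ?thesis"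
  then have bad: "\<exists>w. g w \<le> 0 \<and> w \<noteq> z \<and> dist w z < \<epsilon> \<and> F w \<le> F z" if "\<epsilon> > 0" for \<epsilon>
    using that gz unfolding strict_local_minimizer_def by (auto simp: not_less) (meson linorder_not_le)
  have "\<exists>h. g (z + h) \<le> 0 \<and> h \<noteq> 0 \<and> norm h < inverse (real (Suc n)) \<and> F (z + h) \<le> F z" for n
  proof -
    obtain w where "g w \<le> 0" "w \<noteq> z" "dist w z < inverse (real (Suc n))" "F w \<le> F z"
      using bad[of "inverse (real (Suc n))"] by auto
    then show ?thesis
      by (intro exI[of _ "w - z"]) (auto simp: dist_norm)
  qed
  then obtain h where h: "\<And>n. g (z + h n) \<le> 0" "\<And>n. h n \<noteq> 0"
      "\<And>n. norm (h n) < inverse (real (Suc n))" "\<And>n. F (z + h n) \<le> F z"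
    by metis
  have h0: "h \<longlonglongrightarrow> 0"
    by (rule Lim_null_comparison[OF _ LIMSEQ_inverse_real_of_nat])
      (use h(3) in \<open>auto intro!: always_eventually less_imp_le simp del: of_nat_Suc\<close>)
  define u where "u = (\<lambda>n. h n /\<^sub>R norm (h n))"
  have un: "norm (u n) = 1" for n
    using h(2) by (simp add: u_def)
  \<comment> \<open>Compactness of the unit sphere yields the limit direction \<open>d\<close> of
    the normalized increments along a subsequence.\<close>
  have "compact (sphere (0::'a) 1)" by simp
  then obtain d r where d: "d \<in> sphere 0 1" and r: "strict_mono r" "(u \<circ> r) \<longlonglongrightarrow> d"
    using un unfolding compact_def by (metis dist_0_norm mem_sphere)
  define k where "k = h \<circ> r"
  have k0: "k \<longlonglongrightarrow> 0"
    unfolding k_def by (rule LIMSEQ_subseq_LIMSEQ[OF h0 r(1)])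
  have kat: "filterlim k (at 0) sequentially"
    unfolding filterlim_at using k0 h(2) by (simp add: k_def)
  have knz: "k n \<noteq> 0" and kg: "g (z + k n) \<le> 0" and kF: "F (z + k n) \<le> F z" for n
    using h by (auto simp: k_def)
  have kd: "(\<lambda>n. k n /\<^sub>R norm (k n)) \<longlonglongrightarrow> d"
    using r(2) by (simp add: u_def k_def o_def)
  define R where "R = (\<lambda>h. (F (z + h) + m * g (z + h) - F z - Q h) / (norm h)\<^sup>2)"
  have R0: "(\<lambda>n. R (k n)) \<longlonglongrightarrow> 0"
    using filterlim_compose[OF taylor kat] by (simp add: R_def)
  have Qd: "(\<lambda>n. Q (k n /\<^sub>R norm (k n))) \<longlonglongrightarrow> Q d"
    using continuous_on_tendsto_compose[OF Q_cont kd] by simp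
  have Qk: "Q (k n /\<^sub>R norm (k n)) = Q (k n) / (norm (k n))\<^sup>2" for n
    by (simp add: Q_hom power_divide divide_inverse power_inverse)
  \<comment> \<open>Since \<open>F (z + k n) \<le> F z\<close>, only the constraint term survives as
    an upper bound; it is nonpositive by feasibility.\<close>
  have key: "Q (k n /\<^sub>R norm (k n)) + R (k n) \<le> m * g (z + k n) / (norm (k n))\<^sup>2" for n
  proof -
    have "Q (k n /\<^sub>R norm (k n)) + R (k n) = (F (z + k n) + m * g (z + k n) - F z) / (norm (k n))\<^sup>2"
      unfolding Qk R_def by (simp add: add_divide_distrib[symmetric])
    then show ?thesis
      using kF[of n] by (simp add: divide_right_mono)
  qed
  have "Q (k n /\<^sub>R norm (k n)) + R (k n) \<le> 0" for n
    using order_trans[OF key] kg m by (simp add: divide_nonpos_nonneg mult_nonneg_nonpos)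
  moreover have QR: "(\<lambda>n. Q (k n /\<^sub>R norm (k n)) + R (k n)) \<longlonglongrightarrow> Q d + 0"
    by (intro tendsto_add Qd R0)
  ultimately have "Q d \<le> 0"
    using LIMSEQ_le_const2 by fastforce
  moreover have "g' d = 0"
  proof -
    have bl: "bounded_linear g'"
      using g by (rule has_derivative_bounded_linear)
    have gl: "(\<lambda>n. (g (z + k n) - g' (k n)) / norm (k n)) \<longlonglongrightarrow> 0"
    proof -
      have "((\<lambda>h. (g (z + h) - g z - g' h) / norm h) \<longlongrightarrow> 0) (at 0)"
        by (rule tendsto_norm_zero_cancel) (use g in \<open>simp add: has_derivative_at\<close>)
      from filterlim_compose[OF this kat] show ?thesis
        by (simp add: gz)
    qed
    have "(\<lambda>n. g' (k n /\<^sub>R norm (k n))) \<longlonglongrightarrow> g' d"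
      by (rule bounded_linear.tendsto[OF bl kd])
    then have "(\<lambda>n. g' (k n) / norm (k n)) \<longlonglongrightarrow> g' d"
      by (simp add: linear_simps[OF bl] divide_inverse_commute)
    from tendsto_add[OF gl this]
    have gd: "(\<lambda>n. g (z + k n) / norm (k n)) \<longlonglongrightarrow> g' d"
      by (simp add: add_divide_distrib[symmetric])
    \<comment> \<open>Scaling \<open>key\<close> by \<open>norm (k n) / m\<close> makes its left
      side tend to 0, whence \<open>g' d \<ge> 0\<close>; feasibility gives the opposite
      inequality.\<close>
    have "(\<lambda>n. (Q (k n /\<^sub>R norm (k n)) + R (k n)) * norm (k n) / m) \<longlonglongrightarrow> (Q d + 0) * 0 / m"
      using m by (intro tendsto_intros QR tendsto_norm_zero k0) auto
    moreover have "(Q (k n /\<^sub>R norm (k n)) + R (k n)) * norm (k n) / m \<le> g (z + k n) / norm (k n)" for n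
    proof -
      have "(Q (k n /\<^sub>R norm (k n)) + R (k n)) * norm (k n) / m
          \<le> (m * g (z + k n) / (norm (k n))\<^sup>2) * norm (k n) / m"
        using m by (intro divide_right_mono mult_right_mono key) auto
      also have "\<dots> = g (z + k n) / norm (k n)"
        using m knz by (simp add: power2_eq_square)
      finally show ?thesis .
    qed
    ultimately have "(Q d + 0) * 0 / m \<le> g' d"
      using LIMSEQ_le[OF _ gd] by blast
    moreover have "g' d \<le> 0"
      using kg LIMSEQ_le_const2[OF gd] by (auto simp: divide_nonpos_nonneg)
    ultimately show ?thesis by simp
  qed
  moreover have "d \<noteq> 0" using d by auto
  ultimately show False
    using Q_pos[of d] by simp
qed

subsection \<open>Symmetric forms and eigenvalues\<close>

text \<open>If the form were nonpositive at \<open>z\<close>, it would be nonpositive on the span of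
  \<open>p\<close> and \<open>z\<close>, because \<open>z \<bullet> A p = 0\<close> removes the
  cross term. That plane meets the hyperplane orthogonal to \<open>e\<close> in a nonzero vector,
  where the form is positive.\<close>

lemma pos_on_orthogonal_of_index_one:
  fixes A :: "'a::real_inner \<Rightarrow> 'a"
  assumes lin: "linear A" and sym: "\<And>u v. u \<bullet> A v = v \<bullet> A u"
    and pos: "\<And>v. v \<noteq> 0 \<Longrightarrow> e \<bullet> v = 0 \<Longrightarrow> 0 < v \<bullet> A v"
    and p: "p \<bullet> A p < 0" and z: "z \<noteq> 0" "z \<bullet> A p = 0"
  shows "0 < z \<bullet> A z"
proof (rule ccontr)
  assume neg: "\<not> 0 < z \<bullet> A z"
  interpret A: linear A by fact
  define q where "q = (e \<bullet> z) *\<^sub>R p - (e \<bullet> p) *\<^sub>R z"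
  have "e \<bullet> z \<noteq> 0" using neg pos z(1) by blast
  \<comment> \<open>Pairing with \<open>A p\<close> isolates the coefficient of \<open>p\<close> in
    \<open>q\<close> and so shows that \<open>q\<close> is nonzero.\<close>
  have "q \<bullet> A p = (e \<bullet> z) * (p \<bullet> A p)"
    by (simp add: q_def inner_diff_left z)
  then have "q \<noteq> 0" using p \<open>e \<bullet> z \<noteq> 0\<close> by auto
  moreover have "e \<bullet> q = 0" by (simp add: q_def inner_diff_right)
  ultimately have "0 < q \<bullet> A q" by (rule pos)
  moreover have "q \<bullet> A q = (e \<bullet> z)\<^sup>2 * (p \<bullet> A p) + (e \<bullet> p)\<^sup>2 * (z \<bullet> A z)"
    using z(2) sym[of z p]
    by (simp add: q_def A.diff A.scaleR inner_diff_left inner_diff_right power2_eq_square algebra_simps)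
  moreover have "\<dots> \<le> 0"
    using p neg by (intro add_nonpos_nonpos mult_nonneg_nonpos) auto
  ultimately show False by simp
qed

text \<open>A null vector \<open>e\<close> minimizes the form on \<open>W\<close>; if
  \<open>A e\<close> were nonzero, a small step from \<open>e\<close> along \<open>- A e\<close>
  would make the form negative.\<close>

lemma psd_kernel:
  fixes A :: "'a::real_inner \<Rightarrow> 'a"
  assumes lin: "linear A" and sym: "\<And>u v. u \<bullet> A v = v \<bullet> A u"
    and W: "subspace W" "A ` W \<subseteq> W" and psd: "\<And>v. v \<in> W \<Longrightarrow> 0 \<le> v \<bullet> A v"
    and e: "e \<in> W" "e \<bullet> A e = 0"
  shows "A e = 0"
proof (rule ccontr)
  assume nz: "A e \<noteq> 0"
  interpret A: linear A by fact
  define N where "N = A e \<bullet> A e"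
  define K where "K = A e \<bullet> A (A e)"
  \<comment> \<open>The step must be short enough for the linear term \<open>2 * s * N\<close> to
    outweigh \<open>s\<^sup>2 * K\<close>; the added 1 allows \<open>K = 0\<close>.\<close>
  define s where "s = - N / (K + 1)"
  have eW: "A e \<in> W" using e W(2) by blast
  have N: "N > 0" using nz by (simp add: N_def)
  have K: "K \<ge> 0" using psd[OF eW] by (simp add: K_def)
  have "0 \<le> (e + s *\<^sub>R A e) \<bullet> A (e + s *\<^sub>R A e)"
    using e(1) eW W(1) by (intro psd subspace_add subspace_scale)
  also have "\<dots> = 2 * s * N + s\<^sup>2 * K"
    using sym[of e "A e"] e(2)
    by (simp add: A.add A.scaleR inner_add_left inner_add_right N_def K_def power2_eq_square algebra_simps)
  also have "\<dots> = - (N\<^sup>2 * (K + 2)) / (K + 1)\<^sup>2"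
    using K unfolding s_def by (simp add: divide_simps) (simp add: algebra_simps power2_eq_square)
  also have "\<dots> < 0" using N K by (simp add: divide_neg_pos)
  finally show False by simp
qed

text \<open>The form attains its minimum \<open>\<nu>\<close> on the unit sphere of \<open>W\<close>
  at some \<open>e\<close>. Then \<open>A - \<nu> I\<close> is positive semidefinite on
  \<open>W\<close> and null at \<open>e\<close>, so \<open>psd_kernel\<close> makes \<open>e\<close>
  an eigenvector. The invariant subspace \<open>W\<close> permits a second application, on the
  complement of a first eigenvector.\<close>

lemma symmetric_minimal_eigenvector:
  fixes A :: "'a::euclidean_space \<Rightarrow> 'a"
  assumes lin: "linear A" and sym: "\<And>u v. u \<bullet> A v = v \<bullet> A u"
    and W: "subspace W" "A ` W \<subseteq> W" "W \<noteq> {0}"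
  obtains \<nu> e where "e \<in> W" "norm e = 1" "A e = \<nu> *\<^sub>R e" "\<And>v. v \<in> W \<Longrightarrow> \<nu> * (v \<bullet> v) \<le> v \<bullet> A v"
proof -
  interpret A: linear A by fact
  obtain w where w: "w \<in> W" "w \<noteq> 0" using W(1,3) subspace_0 by blast
  let ?K = "W \<inter> sphere 0 1"
  have "compact ?K"
    by (intro closed_Int_compact closed_subspace W) simp
  moreover have "w /\<^sub>R norm w \<in> ?K" using w W(1) by (auto simp: subspace_scale)
  moreover have "continuous_on ?K (\<lambda>v. v \<bullet> A v)"
    by (intro continuous_intros linear_continuous_on linear_conv_bounded_linear[THEN iffD1] lin)
  ultimately obtain e where e: "e \<in> ?K" and emin: "\<And>v. v \<in> ?K \<Longrightarrow> e \<bullet> A e \<le> v \<bullet> A v"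
    using continuous_attains_inf[of ?K "\<lambda>v. v \<bullet> A v"] by blast
  define \<nu> where "\<nu> = e \<bullet> A e"
  have low: "\<nu> * (v \<bullet> v) \<le> v \<bullet> A v" if "v \<in> W" for v
  proof (cases "v = 0")
    case False
    then have "v /\<^sub>R norm v \<in> ?K" using that W(1) by (auto simp: subspace_scale)
    from emin[OF this] have "\<nu> \<le> (v \<bullet> A v) / (norm v)\<^sup>2"
      by (simp add: A.scaleR \<nu>_def power2_eq_square divide_inverse mult_ac)
    then show ?thesis
      using False by (simp add: pos_le_divide_eq power2_norm_eq_inner)
  qed simp
  have eW: "e \<in> W" and ee: "e \<bullet> e = 1" using e by (auto simp: norm_eq_1)
  have "linear (\<lambda>v. A v - \<nu> *\<^sub>R v)"
    by (intro linear_compose_sub lin linear_scale_self)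
  moreover have "0 \<le> v \<bullet> (A v - \<nu> *\<^sub>R v)" if "v \<in> W" for v
    using low[OF that] by (simp add: inner_diff_right)
  moreover have "u \<bullet> (A v - \<nu> *\<^sub>R v) = v \<bullet> (A u - \<nu> *\<^sub>R u)" for u v
    using sym[of u v] by (simp add: inner_diff_right inner_commute)
  moreover have "(\<lambda>v. A v - \<nu> *\<^sub>R v) ` W \<subseteq> W"
    using W(1,2) by (auto intro!: subspace_diff subspace_scale)
  ultimately have "A e - \<nu> *\<^sub>R e = 0"
    using eW W(1) ee by (intro psd_kernel[of "\<lambda>v. A v - \<nu> *\<^sub>R v" W]) (auto simp: inner_diff_right \<nu>_def)
  then have "A e = \<nu> *\<^sub>R e" by simp
  with that eW e low show thesis by auto
qed

section \<open>Characteristic polynomial and multiplicity of eigenvalues\<close>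

lemma poly_det: "poly (det M) x = det (\<chi> i j. poly (M $ i $ j) x)"
  by (simp add: det_def poly_sum poly_prod)

lemma poly_charpoly: "poly (charpoly A) t = det (t *\<^sub>R mat 1 - A)"
proof -
  have "(\<chi> i j. poly ((mat [:0, 1:] - (\<chi> i j. [:A $ i $ j:])) $ i $ j) t) = t *\<^sub>R mat 1 - A"
    by (simp add: vec_eq_iff mat_def)
  then show ?thesis by (simp add: charpoly_def poly_det)
qed

lemma eigenvalue_root_charpoly:
  fixes A :: "real ^ 'n ^ 'n"
  assumes "A *v v = t *\<^sub>R v" "v \<noteq> 0"
  shows "poly (charpoly A) t = 0"
proof (rule ccontr)
  assume "poly (charpoly A) t \<noteq> 0"
  then have "invertible (t *\<^sub>R mat 1 - A)"
    by (simp add: poly_charpoly invertible_det_nz)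
  moreover have "(t *\<^sub>R mat 1 - A) *v v = 0"
    using assms(1) by (simp add: matrix_vector_mult_diff_rdistrib scaleR_matrix_vector_assoc[symmetric])
  ultimately show False
    using assms(2) by (simp add: invertible_left_inverse matrix_left_invertible_ker)
qed

text \<open>Links geometric multiplicity to the algebraic multiplicity that
  \<open>ordered_eigenvalues\<close> counts; it serves to exclude two independent eigenvectors for
  an eigenvalue below \<open>lam 2\<close>.\<close>

lemma independent_eigenvectors_square_dvd_charpoly:
  fixes A :: "real ^ 'n ^ 'n"
  assumes u: "A *v u = t *\<^sub>R u" "u \<noteq> 0" and w: "A *v w = t *\<^sub>R w" and indep: "\<And>r. w \<noteq> r *\<^sub>R u"
  shows "[:- t, 1:]\<^sup>2 dvd charpoly A"
proof -
  \<comment> \<open>Replacing two columns of the identity by eigenvectors gives an invertible \<open>T\<close> such that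
    two columns of \<open>(x I - A) T\<close> are divisible by \<open>x - t\<close>.\<close>
  obtain i where i: "u $ i \<noteq> 0" using u(2) by (auto simp: vec_eq_iff)
  \<comment> \<open>Clearing coordinate \<open>i\<close> forces \<open>j \<noteq> i\<close> and lets
    \<open>T *v x = 0\<close> be solved in the order \<open>i\<close>, \<open>j\<close>, remaining
    coordinates.\<close>
  define w' where "w' = w - (w $ i / u $ i) *\<^sub>R u"
  have Aw': "A *v w' = t *\<^sub>R w'"
    by (simp add: w'_def matrix_vector_mult_diff_distrib matrix_vector_mult_scaleR u w algebra_simps)
  have w'i: "w' $ i = 0" using i by (simp add: w'_def)
  have "w' \<noteq> 0" using indep by (simp add: w'_def)
  then obtain j where j: "w' $ j \<noteq> 0" by (auto simp: vec_eq_iff)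
  have ij: "i \<noteq> j" using w'i j by auto
  define T :: "real ^ 'n ^ 'n" where
    "T = (\<chi> r k. if k = i then u $ r else if k = j then w' $ r else if r = k then 1 else 0)"
  have Tx: "(T *v x) $ r = u $ r * x $ i + w' $ r * x $ j + (if r = i \<or> r = j then 0 else x $ r)" for x r
  proof -
    have "(T *v x) $ r = (\<Sum>k\<in>UNIV. (if k = i then u $ r * x $ i else 0)
        + (if k = j then w' $ r * x $ j else 0)
        + (if k = r then if r = i \<or> r = j then 0 else x $ r else 0))"
      unfolding matrix_vector_mult_def using ij by (auto simp: T_def intro!: sum.cong)
    then show ?thesis by (simp add: sum.distrib)
  qed
  have "x = 0" if "T *v x = 0" for x
  proof -
    have "x $ i = 0" using Tx[of x i] that i w'i by simp
    moreover from this have "x $ j = 0" using Tx[of x j] that j by simp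
    ultimately have "x $ r = 0" for r using Tx[of x r] that by (auto split: if_splits)
    then show ?thesis by (simp add: vec_eq_iff)
  qed
  then have detT: "det T \<noteq> 0"
    by (simp add: invertible_left_inverse matrix_left_invertible_ker flip: invertible_det_nz)
  \<comment> \<open>The matrix \<open>(x I - A) T\<close> with the factor \<open>x - t\<close> taken
    out of columns \<open>i\<close> and \<open>j\<close>; its other columns are those of
    \<open>x I - A\<close>.\<close>
  define R :: "real poly ^ 'n ^ 'n" where
    "R = (\<chi> r k. if k = i then [:u $ r:] else if k = j then [:w' $ r:]
                 else (if r = k then [:0, 1:] else 0) - [:A $ r $ k:])"
  have "charpoly A * [:det T:] = [:- t, 1:]\<^sup>2 * det R"
  proof (rule poly_eq_poly_eq_iff[THEN iffD1], rule ext)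
    fix x :: real
    define Rx where "Rx = (\<chi> r k. poly (R $ r $ k) x)"
    define d where "d = (\<lambda>k. if k = i \<or> k = j then x - t else 1)"
    define Dg :: "real ^ 'n ^ 'n" where "Dg = (\<chi> r k. if r = k then d k else 0)"
    have "((x *\<^sub>R mat 1 - A) ** T) $ r $ k = (Rx ** Dg) $ r $ k" for r k
    proof -
      have "((x *\<^sub>R mat 1 - A) ** T) $ r $ k = ((x *\<^sub>R mat 1 - A) *v column k T) $ r"
        by (simp add: matrix_matrix_mult_def matrix_vector_mult_def column_def)
      also have "\<dots> = (x *\<^sub>R column k T - A *v column k T) $ r"
        by (simp add: matrix_vector_mult_diff_rdistrib scaleR_matrix_vector_assoc[symmetric])
      also have "\<dots> = Rx $ r $ k * d k"
      proof -
        consider "k = i" | "k = j" | "k \<noteq> i" "k \<noteq> j" by blast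
        then show ?thesis
        proof cases
          case 1
          then have "column k T = u" by (simp add: column_def T_def vec_eq_iff)
          then show ?thesis using 1 by (simp add: u Rx_def R_def d_def algebra_simps)
        next
          case 2
          then have "column k T = w'" using ij by (simp add: column_def T_def vec_eq_iff)
          then show ?thesis using 2 ij by (simp add: Aw' Rx_def R_def d_def algebra_simps)
        next
          case 3
          then have "column k T = axis k 1" by (simp add: column_def T_def vec_eq_iff axis_def)
          then have "A *v column k T = column k A" "column k T = axis k 1"
            by (simp_all add: matrix_vector_mult_basis)
          then show ?thesis using 3
            by (simp add: Rx_def R_def d_def) (simp add: column_def axis_def)
        qed
      qed
      also have "\<dots> = (Rx ** Dg) $ r $ k"
        by (simp add: matrix_matrix_mult_def Dg_def if_distrib cong: if_cong)
      finally show ?thesis .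
    qed
    then have "(x *\<^sub>R mat 1 - A) ** T = Rx ** Dg" by (simp add: vec_eq_iff)
    then have "det (x *\<^sub>R mat 1 - A) * det T = det Rx * det Dg"
      by (metis det_mul)
    moreover have "det Dg = (x - t)\<^sup>2"
    proof -
      have "det Dg = (\<Prod>k\<in>UNIV. d k)"
        by (subst det_diagonal) (auto simp: Dg_def)
      also have "\<dots> = (\<Prod>k\<in>{i, j}. d k)"
        by (rule prod.mono_neutral_right) (auto simp: d_def)
      finally show ?thesis using ij by (simp add: d_def power2_eq_square)
    qed
    ultimately show "poly (charpoly A * [:det T:]) x = poly ([:- t, 1:]\<^sup>2 * det R) x"
      by (simp add: poly_charpoly poly_det Rx_def mult.commute)
  qed
  then have "[:- t, 1:]\<^sup>2 dvd smult (det T) (charpoly A)"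
    by (simp add: dvd_def)
  then show ?thesis
    using detT by (simp add: dvd_smult_iff)
qed

lemma poly_charpoly_eq_0_iff:
  assumes "ordered_eigenvalues A lam"
  shows "poly (charpoly (A :: real ^ 'n ^ 'n)) t = 0 \<longleftrightarrow> (\<exists>i\<in>{1..CARD('n)}. t = lam i)"
  using assms by (simp add: ordered_eigenvalues_def poly_prod)

lemma eigenvalue_less_second:
  fixes A :: "real ^ 'n ^ 'n"
  assumes "ordered_eigenvalues A lam" "A *v v = t *\<^sub>R v" "v \<noteq> 0" "t < lam 2"
  shows "t = lam 1"
proof -
  obtain i where i: "i \<in> {1..CARD('n)}" "t = lam i"
    using poly_charpoly_eq_0_iff[OF assms(1)] eigenvalue_root_charpoly[OF assms(2,3)] by blast
  have "\<not> 2 \<le> i"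
  proof
    assume "2 \<le> i"
    \<comment> \<open>As \<open>2 \<le> i \<le> CARD('n)\<close>, the index 2 lies in the range on
      which \<open>lam\<close> is monotone.\<close>
    then have "lam 2 \<le> lam i"
      using assms(1) i(1) unfolding ordered_eigenvalues_def by (intro mono_onD[of "{1..CARD('n)}" lam]) auto
    with i assms(4) show False by simp
  qed
  with i have "i = 1" by auto
  with i show ?thesis by simp
qed

text \<open>A kernel vector would be an eigenvector of \<open>A\<close> for \<open>- t\<close>, but
  an eigenvalue below \<open>lam 2\<close> equals \<open>lam 1\<close>, and \<open>- t\<close>
  exceeds \<open>lam 1\<close>.\<close>

lemma invertible_shift_between_eigenvalues:
  fixes A :: "real ^ 'n ^ 'n"
  assumes "ordered_eigenvalues A lam" "- lam 2 < t" "t < - lam 1"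
  shows "invertible (A + t *\<^sub>R mat 1)"
proof -
  have "v = 0" if "(A + t *\<^sub>R mat 1) *v v = 0" for v
  proof (rule ccontr)
    assume "v \<noteq> 0"
    moreover have "A *v v = (- t) *\<^sub>R v"
      using that by (simp add: matrix_vector_mult_add_rdistrib scaleR_matrix_vector_assoc[symmetric] eq_neg_iff_add_eq_0)
    ultimately show False
      using eigenvalue_less_second[OF assms(1), of v "- t"] assms by auto
  qed
  then show ?thesis
    by (simp add: invertible_left_inverse matrix_left_invertible_ker)
qed

lemma inner_symmetric_matrix:
  fixes A :: "real ^ 'n ^ 'n"
  assumes "transpose A = A"
  shows "u \<bullet> (A *v v) = v \<bullet> (A *v u)"
  using assms by (metis dot_lmul_matrix inner_commute transpose_matrix_vector)

text \<open>Take \<open>e\<close> to be an eigenvector for the smallest eigenvalue. On its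
  orthogonal complement, which is invariant, the minimum of the Rayleigh quotient is again an
  eigenvalue \<open>\<nu>'\<close>, and counting multiplicities shows
  \<open>\<nu>' \<ge> lam 2 > - t\<close>.\<close>

lemma positive_on_hyperplane_above_second_eigenvalue:
  fixes A :: "real ^ 'n ^ 'n"
  assumes sym: "transpose A = A" and eig: "ordered_eigenvalues A lam" and t: "- lam 2 < t"
  obtains e where "\<And>v. v \<noteq> 0 \<Longrightarrow> e \<bullet> v = 0 \<Longrightarrow> 0 < v \<bullet> ((A + t *\<^sub>R mat 1) *v v)"
proof -
  note symA = inner_symmetric_matrix[OF sym]
  obtain \<nu> e where e: "norm e = 1" "A *v e = \<nu> *\<^sub>R e" "\<And>v. \<nu> * (v \<bullet> v) \<le> v \<bullet> (A *v v)"
  proof (rule symmetric_minimal_eigenvector[of "(*v) A" UNIV])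
    show "(UNIV :: (real ^ 'n) set) \<noteq> {0}"
      by (metis UNIV_I axis_eq_0_iff singletonD zero_neq_one)
  qed (auto simp: symA)
  let ?W = "{v. e \<bullet> v = 0}"
  have low: "\<mu> * (v \<bullet> v) < v \<bullet> (A *v v)" if v: "v \<noteq> 0" "e \<bullet> v = 0" and \<mu>: "\<mu> < lam 2" for v \<mu>
  proof -
    obtain \<nu>' e' where e': "e' \<in> ?W" "norm e' = 1" "A *v e' = \<nu>' *\<^sub>R e'"
        "\<And>v. v \<in> ?W \<Longrightarrow> \<nu>' * (v \<bullet> v) \<le> v \<bullet> (A *v v)"
    proof (rule symmetric_minimal_eigenvector[of "(*v) A" ?W])
      show "subspace ?W" by (rule subspace_hyperplane)
      show "(*v) A ` ?W \<subseteq> ?W" using symA[of e] e(2) by (auto simp: inner_commute)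
      show "?W \<noteq> {0}" using v by auto
    qed (auto simp: symA)
    have "lam 2 \<le> \<nu>'"
    proof (rule ccontr)
      assume "\<not> lam 2 \<le> \<nu>'"
      then have \<nu>': "\<nu>' < lam 2" by simp
      have "\<nu> \<le> \<nu>'" using e(3)[of e'] e'(2,3) by (simp add: norm_eq_1)
      then have eq: "\<nu> = lam 1" "\<nu>' = lam 1"
        using eigenvalue_less_second[OF eig] e e' \<nu>' by fastforce+
      have "e' \<noteq> r *\<^sub>R e" for r
        using e'(1,2) e(1) by (auto simp: norm_eq_1)
      then have "[:- lam 1, 1:]\<^sup>2 dvd charpoly A"
        using e e' eq by (intro independent_eigenvectors_square_dvd_charpoly[of A e _ e']) auto
      also have "charpoly A = (\<Prod>i = 1..CARD('n). [:- lam i, 1:])"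
        using eig by (simp add: ordered_eigenvalues_def)
      \<comment> \<open>Cancelling one of the two factors for \<open>lam 1\<close> leaves
        \<open>lam 1\<close> as a root of the product over \<open>i \<ge> 2\<close>. Then
        \<open>lam 2 \<le> lam 1 = \<nu>'\<close>, against \<open>\<nu>' < lam 2\<close>.\<close>
      also have "\<dots> = [:- lam 1, 1:] * (\<Prod>i = 2..CARD('n). [:- lam i, 1:])"
        by (subst prod.atLeast_Suc_atMost) (auto simp: numeral_2_eq_2)
      finally have "[:- lam 1, 1:] dvd (\<Prod>i = 2..CARD('n). [:- lam i, 1:])"
        unfolding power2_eq_square by (subst (asm) dvd_mult_cancel_left) auto
      then have "poly (\<Prod>i = 2..CARD('n). [:- lam i, 1:]) (lam 1) = 0"
        by (simp add: poly_eq_0_iff_dvd)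
      then obtain i where i: "i \<in> {2..CARD('n)}" "lam i = lam 1"
        by (auto simp: poly_prod)
      then have "lam 2 \<le> lam i"
        using eig unfolding ordered_eigenvalues_def by (intro mono_onD[of "{1..CARD('n)}" lam]) auto
      with i eq \<nu>' show False by simp
    qed
    with \<mu> have "\<mu> * (v \<bullet> v) < \<nu>' * (v \<bullet> v)" using v by simp
    also have "\<dots> \<le> v \<bullet> (A *v v)" using e'(4) v by simp
    finally show ?thesis .
  qed
  show thesis
  proof (rule that)
    fix v assume v: "v \<noteq> 0" "e \<bullet> v = 0"
    show "0 < v \<bullet> ((A + t *\<^sub>R mat 1) *v v)"
      using low[OF v, of "- t"] t
      by (simp add: matrix_vector_mult_add_rdistrib scaleR_matrix_vector_assoc[symmetric] inner_add_right)
  qed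
qed

section \<open>Inverse matrices and the derivative of \<open>phi\<close>\<close>

lemma matrix_inv_vector_mult:
  fixes A :: "real ^ 'n ^ 'n"
  assumes "invertible A"
  shows "A *v (matrix_inv A *v x) = x" "matrix_inv A *v (A *v x) = x"
proof -
  have "A ** matrix_inv A = mat 1 \<and> matrix_inv A ** A = mat 1"
    using assms unfolding invertible_def matrix_inv_def by (rule someI_ex)
  then show "A *v (matrix_inv A *v x) = x" "matrix_inv A *v (A *v x) = x"
    by (simp_all add: matrix_vector_mul_assoc)
qed

text \<open>With \<open>X t\<close> the solution of the shifted system, the resolvent identity gives
  in turn local boundedness of \<open>X\<close>, its continuity at \<open>\<mu>\<close>, and an
  explicit difference quotient for the squared norm.\<close>

lemma has_derivative_phi:
  fixes H :: "real ^ 'n ^ 'n"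
  assumes S: "open S" "\<mu> \<in> S" and inv: "\<And>t. t \<in> S \<Longrightarrow> invertible (H + t *\<^sub>R mat 1)"
  defines "B \<equiv> matrix_inv (H + \<mu> *\<^sub>R mat 1)"
  shows "(phi H c has_field_derivative - 2 * ((B *v c) \<bullet> (B *v (B *v c)))) (at \<mu>)"
proof -
  define X where "X = (\<lambda>t. matrix_inv (H + t *\<^sub>R mat 1) *v c)"
  have X\<mu>: "X \<mu> = B *v c" by (simp add: X_def B_def)
  \<comment> \<open>the resolvent identity\<close>
  have res: "X t - X \<mu> = - (t - \<mu>) *\<^sub>R (B *v X t)" if "t \<in> S" for t
  proof -
    let ?A = "H + \<mu> *\<^sub>R mat 1"
    have "(H + t *\<^sub>R mat 1) *v X t = c"
      unfolding X_def by (rule matrix_inv_vector_mult[OF inv[OF that]])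
    then have "?A *v X t = c - (t - \<mu>) *\<^sub>R X t"
      by (simp add: matrix_vector_mult_add_rdistrib scaleR_matrix_vector_assoc[symmetric] algebra_simps)
    moreover have "X t = B *v (?A *v X t)"
      unfolding B_def by (rule matrix_inv_vector_mult(2)[OF inv[OF S(2)], symmetric])
    ultimately have "X t = B *v c - (t - \<mu>) *\<^sub>R (B *v X t)"
      by (simp add: matrix_vector_mult_diff_distrib matrix_vector_mult_scaleR)
    then have "X t - B *v c = - ((t - \<mu>) *\<^sub>R (B *v X t))"
      by (metis add_diff_cancel_left' diff_add_cancel minus_diff_eq)
    then show ?thesis by (simp add: X\<mu> scaleR_left_diff_distrib)
  qed
  have evS: "\<forall>\<^sub>F t in at \<mu>. t \<in> S" using S by (rule eventually_at_in_open')
  obtain K where K: "K > 0" "\<And>x. norm (B *v x) \<le> norm x * K"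
    using bounded_linear.pos_bounded[OF matrix_vector_mul_bounded_linear[of B]] by blast
  \<comment> \<open>For such \<open>t\<close> the resolvent identity bounds
    \<open>X t - X \<mu>\<close> by half of \<open>norm (X t)\<close>, which is absorbed into the
    left side.\<close>
  have bound: "norm (X t) \<le> 2 * norm (X \<mu>)" if "t \<in> S" "\<bar>t - \<mu>\<bar> < 1 / (2 * K)" for t
  proof -
    have "norm (X t) \<le> norm (X \<mu>) + norm (X t - X \<mu>)" by norm
    also have "norm (X t - X \<mu>) = \<bar>t - \<mu>\<bar> * norm (B *v X t)" using res[OF that(1)] by (simp add: abs_minus_commute)
    also have "\<dots> \<le> 1 / (2 * K) * (norm (X t) * K)"
      using that K by (intro mult_mono) auto
    also have "\<dots> = norm (X t) / 2" using K(1) by simp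
    finally show ?thesis by simp
  qed
  have "((\<lambda>t. X t - X \<mu>) \<longlongrightarrow> 0) (at \<mu>)"
  proof (rule Lim_null_comparison)
    have "\<forall>\<^sub>F t in at \<mu>. \<bar>t - \<mu>\<bar> < 1 / (2 * K)"
      unfolding eventually_at using K by (intro exI[of _ "1 / (2 * K)"]) (auto simp: dist_real_def)
    with evS show "\<forall>\<^sub>F t in at \<mu>. norm (X t - X \<mu>) \<le> \<bar>t - \<mu>\<bar> * (2 * norm (X \<mu>) * K)"
    proof eventually_elim
      case (elim t)
      have "norm (B *v X t) \<le> norm (X t) * K" by (rule K)
      also have "\<dots> \<le> 2 * norm (X \<mu>) * K" using bound[OF elim] K(1) by simp
      finally show ?case using res[OF elim(1)] by (simp add: abs_minus_commute mult_left_mono)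
    qed
    show "((\<lambda>t. \<bar>t - \<mu>\<bar> * (2 * norm (X \<mu>) * K)) \<longlongrightarrow> 0) (at \<mu>)"
      by (auto intro!: tendsto_eq_intros)
  qed
  then have Xlim: "(X \<longlongrightarrow> X \<mu>) (at \<mu>)" by (simp add: LIM_zero_iff)
  have "((\<lambda>t. ((norm (X t))\<^sup>2 - (norm (X \<mu>))\<^sup>2) / (t - \<mu>)) \<longlongrightarrow> - 2 * (X \<mu> \<bullet> (B *v X \<mu>))) (at \<mu>)"
  proof (rule Lim_transform_eventually)
    show "((\<lambda>t. - ((X t + X \<mu>) \<bullet> (B *v X t))) \<longlongrightarrow> - 2 * (X \<mu> \<bullet> (B *v X \<mu>))) (at \<mu>)"
    proof -
      have "((\<lambda>t. - ((X t + X \<mu>) \<bullet> (B *v X t))) \<longlongrightarrow> - ((X \<mu> + X \<mu>) \<bullet> (B *v X \<mu>))) (at \<mu>)"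
        by (intro tendsto_intros bounded_linear.tendsto[OF matrix_vector_mul_bounded_linear] Xlim)
      then show ?thesis
        unfolding inner_add_left by simp
    qed
    show "\<forall>\<^sub>F t in at \<mu>. - ((X t + X \<mu>) \<bullet> (B *v X t)) = ((norm (X t))\<^sup>2 - (norm (X \<mu>))\<^sup>2) / (t - \<mu>)"
      using evS eventually_neq_at_within[of \<mu> \<mu> UNIV]
    proof eventually_elim
      case (elim t)
      \<comment> \<open>A difference of squares as sum times difference; the resolvent identity then
        supplies the factor \<open>t - \<mu>\<close> that cancels.\<close>
      have "(norm (X t))\<^sup>2 - (norm (X \<mu>))\<^sup>2 = (X t + X \<mu>) \<bullet> (X t - X \<mu>)"
        unfolding power2_norm_eq_inner inner_add_left inner_diff_right by (simp add: inner_commute)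
      also have "\<dots> = - (t - \<mu>) * ((X t + X \<mu>) \<bullet> (B *v X t))"
        by (simp add: res[OF elim(1)] minus_mult_left[symmetric] del: inner_add_left)
      finally show ?case using elim(2) by (simp add: divide_simps) (simp add: algebra_simps)
    qed
  qed
  then show ?thesis
    unfolding has_field_derivative_iff by (simp add: phi_def X_def B_def)
qed

subsection \<open>Strict local minimality\<close>

text \<open>\<open>inverse_exists\<close> states that the bracket in the second-order condition has
  an inverse; \<open>matrix_inv\<close> of a singular matrix is unspecified.
  \<open>deriv (phi H c) \<mu>\<close> is a true derivative because \<open>\<mu>\<close> lies
  strictly between \<open>- lam 2\<close> and \<open>- lam 1\<close>.\<close>

theorem theorem6:
  fixes H :: "real ^ 'n ^ 'n" and c :: "real ^ 'n"
    and f0 f :: "real ^ 'm \<Rightarrow> real"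
    and lam :: "nat \<Rightarrow> real" and \<mu> :: real
    and xs :: "real ^ 'n" and ys :: "real ^ 'm"
  assumes n_ge_2: "2 \<le> CARD('n)"
    and H_sym: "transpose H = H"
    and H_not_psd: "\<not> pos_semidef H"
    and f0_convex: "convex_on UNIV f0" and f0_C2: "twice_cont_diff f0"
    and f_convex: "convex_on UNIV f" and f_C2: "twice_cont_diff f"
    and slater: "{y. f y < 0} \<noteq> {}"
    and eigenvalues: "ordered_eigenvalues H lam"
    and hess_pd: "\<And>y. f y < 0 \<Longrightarrow>
          \<exists>\<mu>y>0. pos_def (hess f0 y + (\<mu>y / 2) *\<^sub>R hess f y)"
    and mu_range: "\<mu> \<in> {max 0 (- lam 2) <..< - lam 1}"
    and stat_x: "(H + \<mu> *\<^sub>R mat 1) *v xs = - c"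
    and stat_y: "grad f0 ys + (\<mu> / 2) *\<^sub>R grad f ys = 0"
    and active: "xs \<bullet> xs + f ys = 0"
    and inverse_exists: "invertible (hess f0 ys + (\<mu> / 2) *\<^sub>R hess f ys)"
    and second_order: "deriv (phi H c) \<mu> >
          (1/2) * (grad f ys \<bullet>
            (matrix_inv (hess f0 ys + (\<mu> / 2) *\<^sub>R hess f ys) *v grad f ys))"
  shows "strict_local_minimizer (feasible_set f) (objective H c f0) (xs, ys)"
proof -
  define A where "A = H + \<mu> *\<^sub>R mat 1"
  define B where "B = hess f0 ys + (\<mu> / 2) *\<^sub>R hess f ys"
  define \<gamma> where "\<gamma> = grad f ys"
  \<comment> \<open>The Lagrangian splits into a quadratic in \<open>x\<close> with matrix
    \<open>A\<close> and the function \<open>l\<close> of \<open>y\<close>, whose Hessian at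
    \<open>ys\<close> is \<open>B\<close>.\<close>
  define l where "l = (\<lambda>y. f0 y + (\<mu> / 2) * f y)"
  define gl where "gl = (\<lambda>y. grad f0 y + (\<mu> / 2) *\<^sub>R grad f y)"
  define M :: "(real ^ 'n) \<times> (real ^ 'm) \<Rightarrow> (real ^ 'n) \<times> (real ^ 'm)"
    where "M = (\<lambda>(u, v). (A *v u, B *v v))"
  define g where "g = (\<lambda>(x :: real ^ 'n, y). x \<bullet> x + f y)"
  have \<mu>: "\<mu> > 0" "- lam 2 < \<mu>" "\<mu> < - lam 1" using mu_range by auto
  have A_inv: "invertible A"
    unfolding A_def by (rule invertible_shift_between_eigenvalues[OF eigenvalues \<mu>(2,3)])
  have A_mult: "A *v u = H *v u + \<mu> *\<^sub>R u" for u
    by (simp add: A_def matrix_vector_mult_add_rdistrib scaleR_matrix_vector_assoc[symmetric])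
  have A_sym: "u \<bullet> (A *v v) = v \<bullet> (A *v u)" for u v
    using inner_symmetric_matrix[OF H_sym, of u v] by (simp add: A_mult inner_add_right inner_commute)
  have l_deriv: "(l has_derivative (\<lambda>h. gl y \<bullet> h)) (at y)" for y
    unfolding l_def gl_def
    by (rule derivative_eq_intros has_derivative_twice_cont_diff f0_C2 f_C2 refl | simp add: inner_add_left)+
  have gl_deriv: "(gl has_derivative (\<lambda>h. B *v h)) (at ys)"
    unfolding gl_def B_def
    by (rule derivative_eq_intros has_derivative_twice_cont_diff f0_C2 f_C2 refl
        | simp add: matrix_vector_mult_add_rdistrib scaleR_matrix_vector_assoc[symmetric])+
  have B_sym: "u \<bullet> (B *v v) = v \<bullet> (B *v u)" for u v
    by (rule second_derivative_symmetric[OF l_deriv gl_deriv])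
  have "convex_on UNIV l"
    unfolding l_def using \<mu>(1) by (intro convex_on_add convex_on_cmul f0_convex f_convex) auto
  then have B_psd: "0 \<le> v \<bullet> (B *v v)" for v
    by (rule convex_on_second_derivative_nonneg[OF l_deriv gl_deriv])
  have B_inv: "invertible B" using inverse_exists by (simp add: B_def)
  \<comment> \<open>By \<open>psd_kernel\<close> a null vector of this semidefinite form lies in the
    kernel of \<open>B\<close>, which is trivial.\<close>
  have B_pd: "0 < v \<bullet> (B *v v)" if "v \<noteq> 0" for v
  proof -
    have "v = matrix_inv B *v (B *v v)" by (rule matrix_inv_vector_mult(2)[OF B_inv, symmetric])
    then have "B *v v \<noteq> 0" using that by auto
    then have "v \<bullet> (B *v v) \<noteq> 0"
      using psd_kernel[of "(*v) B" UNIV v] B_sym B_psd by auto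
    with B_psd[of v] show ?thesis by simp
  qed

  have M_lin: "linear M"
    by (rule linearI) (auto simp: M_def matrix_vector_right_distrib matrix_vector_mult_scaleR)
  have M_sym: "h \<bullet> M k = k \<bullet> M h" for h k
    using A_sym[of "fst h" "fst k"] B_sym[of "snd h" "snd k"]
    by (simp add: M_def split_beta inner_prod_def)
  obtain e where e: "\<And>u. u \<noteq> 0 \<Longrightarrow> e \<bullet> u = 0 \<Longrightarrow> 0 < u \<bullet> (A *v u)"
    by (rule positive_on_hyperplane_above_second_eigenvalue[OF H_sym eigenvalues \<mu>(2), folded A_def]) blast
  \<comment> \<open>The hyperplane restricts only the \<open>x\<close> component, since
    \<open>B\<close> is positive definite on the other one.\<close>
  have M_pos: "0 < h \<bullet> M h" if h: "h \<noteq> 0" "(e, 0) \<bullet> h = 0" for h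
  proof -
    have "0 \<le> fst h \<bullet> (A *v fst h)" "fst h \<noteq> 0 \<Longrightarrow> 0 < fst h \<bullet> (A *v fst h)"
      using e[of "fst h"] h by (cases "fst h = 0"; auto simp: inner_prod_def)+
    then show ?thesis
      using h(1) B_psd[of "snd h"] B_pd[of "snd h"]
      by (auto simp: M_def split_beta inner_prod_def prod_eq_iff add_pos_nonneg add_nonneg_pos)
  qed

  define p where "p = (2 *\<^sub>R (matrix_inv A *v xs), matrix_inv B *v \<gamma>)"
  have Mp: "M p = (2 *\<^sub>R xs, \<gamma>)"
    by (simp add: M_def p_def matrix_vector_mult_scaleR matrix_inv_vector_mult A_inv B_inv)
  have inv_c: "matrix_inv A *v c = - xs"
    using matrix_inv_vector_mult(2)[OF A_inv, of "- xs"] stat_x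
    by (simp add: A_def[symmetric] linear_neg[OF matrix_vector_mul_linear] minus_equation_iff[of _ xs])
  have "(phi H c has_field_derivative
      - 2 * ((matrix_inv A *v c) \<bullet> (matrix_inv A *v (matrix_inv A *v c)))) (at \<mu>)"
    unfolding A_def
  proof (rule has_derivative_phi[of "{- lam 2 <..< - lam 1}"])
    show "invertible (H + t *\<^sub>R mat 1)" if "t \<in> {- lam 2 <..< - lam 1}" for t
      using that by (intro invertible_shift_between_eigenvalues[OF eigenvalues]) auto
  qed (use \<mu> in auto)
  then have "deriv (phi H c) \<mu> = - 2 * (xs \<bullet> (matrix_inv A *v xs))"
    by (simp add: DERIV_imp_deriv inv_c linear_neg[OF matrix_vector_mul_linear])
  \<comment> \<open>Here \<open>p \<bullet> M p\<close> equals \<open>4 * (xs \<bullet> (matrix_inv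
    A *v xs)) + \<gamma> \<bullet> (matrix_inv B *v \<gamma>)\<close>, and its first summand is
    \<open>- 2 * deriv (phi H c) \<mu>\<close>.\<close>
  then have "p \<bullet> M p < 0"
    using second_order unfolding Mp
    by (simp add: p_def inner_commute B_def[symmetric] \<gamma>_def[symmetric])
  then have M_tangent: "0 < h \<bullet> M h" if "h \<noteq> 0" "h \<bullet> M p = 0" for h
    using pos_on_orthogonal_of_index_one[OF M_lin M_sym M_pos] that by blast

  have "strict_local_minimizer {z. g z \<le> 0} (objective H c f0) (xs, ys)"
  \<comment> \<open>\<open>M p\<close> is the constraint gradient at \<open>(xs, ys)\<close>, so
    \<open>h \<bullet> M p\<close> is the derivative of \<open>g\<close>; \<open>Q\<close> includes
    the factor 1/2 of the second-order term.\<close>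
  proof (rule strict_local_minimizer_second_order[where g' = "\<lambda>h. h \<bullet> M p" and m = "\<mu> / 2"
        and Q = "\<lambda>h. h \<bullet> M h / 2"])
    have "((\<lambda>z. fst z \<bullet> fst z + f (snd z)) has_derivative
        (\<lambda>h. (fst (xs, ys) \<bullet> fst h + fst h \<bullet> fst (xs, ys)) + \<gamma> \<bullet> snd h)) (at (xs, ys))"
    proof (intro has_derivative_add has_derivative_inner has_derivative_fst has_derivative_ident)
      show "((\<lambda>z. f (snd z)) has_derivative (\<lambda>h. \<gamma> \<bullet> snd h)) (at (xs, ys))"
        using has_derivative_compose[OF has_derivative_snd[OF has_derivative_ident], of f _ "(xs, ys)"]
          has_derivative_twice_cont_diff(1)[OF f_C2, of ys] by (simp add: \<gamma>_def)
    qed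
    then show "(g has_derivative (\<lambda>h. h \<bullet> M p)) (at (xs, ys))"
      by (simp add: g_def Mp case_prod_unfold inner_prod_def inner_commute)
    show "g (xs, ys) = 0" using active by (simp add: g_def)
    show "\<mu> / 2 > 0" using \<mu> by simp
    define R where "R = (\<lambda>v. (l (ys + v) - l ys - gl ys \<bullet> v - v \<bullet> (B *v v) / 2) / (norm v)\<^sup>2)"
    have "(R \<longlongrightarrow> 0) (at 0)"
      unfolding R_def by (rule taylor2_peano[OF l_deriv gl_deriv])
    \<comment> \<open>The value \<open>R 0 = 0\<close> must be included: \<open>snd h\<close> may
      vanish for nonzero \<open>h\<close>.\<close>
    then have "(R \<longlongrightarrow> 0) (nhds 0)"
      using tendsto_at_iff_tendsto_nhds[of R 0] by (simp add: R_def)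
    moreover have "((\<lambda>h :: (real ^ 'n) \<times> (real ^ 'm). snd h) \<longlongrightarrow> 0) (at 0)"
      by (auto intro!: tendsto_eq_intros)
    ultimately have R: "((\<lambda>h :: (real ^ 'n) \<times> (real ^ 'm). R (snd h)) \<longlongrightarrow> 0) (at 0)"
      by (rule filterlim_compose)
    show "((\<lambda>h. (objective H c f0 ((xs, ys) + h) + \<mu> / 2 * g ((xs, ys) + h)
        - objective H c f0 (xs, ys) - h \<bullet> M h / 2) / (norm h)\<^sup>2) \<longlongrightarrow> 0) (at 0)"
    proof (rule Lim_null_comparison[OF always_eventually tendsto_norm_zero[OF R]], rule allI)
      fix h :: "(real ^ 'n) \<times> (real ^ 'm)"
      obtain u v where h: "h = (u, v)" by (cases h)
      let ?N = "l (ys + v) - l ys - gl ys \<bullet> v - v \<bullet> (B *v v) / 2"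
      have c: "c = - (A *v xs)" using stat_x by (simp add: A_def)
      \<comment> \<open>The Lagrangian is exactly quadratic in \<open>x\<close>, and its linear term
        there vanishes by stationarity, so only the Taylor remainder of \<open>l\<close> is
        left.\<close>
      have "objective H c f0 ((xs, ys) + h) + \<mu> / 2 * g ((xs, ys) + h)
          - objective H c f0 (xs, ys) - h \<bullet> M h / 2
          = ?N + \<mu> / 2 * (xs \<bullet> xs + f ys)"
        using stat_y inner_symmetric_matrix[OF H_sym, of u xs]
        by (simp add: h objective_def g_def l_def gl_def M_def c A_mult matrix_vector_right_distrib
            inner_add_left inner_add_right inner_diff_right inner_commute field_simps)
      also have "\<dots> = ?N" using active by simp
      finally have eq: "objective H c f0 ((xs, ys) + h) + \<mu> / 2 * g ((xs, ys) + h)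
          - objective H c f0 (xs, ys) - h \<bullet> M h / 2 = ?N" .
      have "norm (?N / (norm h)\<^sup>2) \<le> norm (R v)"
      proof (cases "v = 0")
        case False
        then have "\<bar>?N\<bar> / (norm h)\<^sup>2 \<le> \<bar>?N\<bar> / (norm v)\<^sup>2"
          using norm_snd_le[of v u] by (intro divide_left_mono power_mono) (auto simp: h zero_prod_def)
        then show ?thesis by (simp add: R_def)
      qed simp
      then show "norm ((objective H c f0 ((xs, ys) + h) + \<mu> / 2 * g ((xs, ys) + h)
          - objective H c f0 (xs, ys) - h \<bullet> M h / 2) / (norm h)\<^sup>2) \<le> norm (R (snd h))"
        unfolding eq by (simp add: h)
    qed
    show "continuous_on UNIV (\<lambda>h. h \<bullet> M h / 2)"
      by (intro continuous_intros linear_continuous_on linear_conv_bounded_linear[THEN iffD1] M_lin) auto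
    show "(r *\<^sub>R h) \<bullet> M (r *\<^sub>R h) / 2 = r\<^sup>2 * (h \<bullet> M h / 2)" for r h
      by (simp add: linear_scale[OF M_lin] power2_eq_square)
    show "0 < h \<bullet> M h / 2" if "h \<noteq> 0" "h \<bullet> M p = 0" for h
      using M_tangent[OF that] by simp
  qed
  then show ?thesis by (simp add: g_def feasible_set_def case_prod_unfold)
qed

end
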